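(* Let $k\geq 1$ and let $G$ be a $k$-connected graph without self-loops. Then $$(-1)^{k+1}\sum_{A\subseteq E(G)} (-1)^{\ell(A)}\, \beta(A) \binom{\mathrm{rk}(A)}{k} = 1+\sum_{\substack{S\subset V(G) \\ |S|=k}} \Big(|\pi_0(G\setminus S)| -1 \Big).$$
   Context: Graphs are finite and undirected; multiple edges are allowed. A graph is $k$-connected if it has more than $k$ vertices and $G\setminus S$ is connected for every subset $S$ of fewer than $k$ vertices, where $G\setminus S$ denotes deletion of the vertices $S$ and all edges incident to them. $\pi_0(H)$ is the set of connected components of a graph $H$. For an edge set $A\subseteq E(G)$, $\mathrm{rk}(A)$ is its rank in the cycle matroid of $G$, $\ell(A)=|A|-\mathrm{rk}(A)$, and $\beta(A)=(-1)^{\mathrm{rk}(A)}\sum_{B\subseteq A}(-1)^{|B|}\,\mathrm{rk}(B)$ is Crapo's invariant of the cycle matroid restricted to $A$. The binomial coefficient $\binom{m}{k}$ is $0$ if $k>m\ge 0$. *)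

theory Defs
  imports Complex_Main
begin

text \<open>Undirected multigraphs: edges are abstract objects, and \<open>ends e\<close> is the set of end vertices of
  \<open>e\<close>. It is a singleton exactly when \<open>e\<close> is a self-loop.\<close>

record ('v, 'e) multigraph =
  verts :: "'v set"
  edges :: "'e set"
  ends :: "'e \<Rightarrow> 'v set"

definition finite_multigraph :: "('v, 'e) multigraph \<Rightarrow> bool" where
  "finite_multigraph G \<longleftrightarrow> finite (verts G) \<and> finite (edges G) \<and>
     (\<forall>e \<in> edges G. ends G e \<subseteq> verts G \<and> (card (ends G e) = 1 \<or> card (ends G e) = 2))"

definition loopless :: "('v, 'e) multigraph \<Rightarrow> bool" where
  "loopless G \<longleftrightarrow> (\<forall>e \<in> edges G. card (ends G e) \<noteq> 1)"

definition delete_verts :: "('v, 'e) multigraph \<Rightarrow> 'v set \<Rightarrow> ('v, 'e) multigraph" where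
  "delete_verts G S =
     \<lparr>verts = verts G - S, edges = {e \<in> edges G. ends G e \<inter> S = {}}, ends = ends G\<rparr>"

definition adjacency :: "('v, 'e) multigraph \<Rightarrow> ('v \<times> 'v) set" where
  "adjacency G = {(u, v). \<exists>e \<in> edges G. ends G e = {u, v}}"

definition linked :: "('v, 'e) multigraph \<Rightarrow> ('v \<times> 'v) set" where
  "linked G = {(u, v). u \<in> verts G \<and> v \<in> verts G \<and> (u, v) \<in> (adjacency G)\<^sup>*}"

text \<open>A connected component is represented by its vertex set.\<close>

definition components :: "('v, 'e) multigraph \<Rightarrow> 'v set set" where
  "components G = verts G // linked G"

definition connected_graph :: "('v, 'e) multigraph \<Rightarrow> bool" where
  "connected_graph G \<longleftrightarrow> verts G \<noteq> {} \<and> (\<forall>u \<in> verts G. \<forall>v \<in> verts G. (u, v) \<in> linked G)"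

definition k_connected :: "nat \<Rightarrow> ('v, 'e) multigraph \<Rightarrow> bool" where
  "k_connected k G \<longleftrightarrow> card (verts G) > k \<and>
     (\<forall>S. S \<subseteq> verts G \<and> card S < k \<longrightarrow> connected_graph (delete_verts G S))"

text \<open>The vertices \<open>vs\<close> and edges \<open>es\<close> in cyclic order. Length 1 is a self-loop and length 2 is a
  pair of distinct parallel edges.\<close>

definition is_cycle :: "('v, 'e) multigraph \<Rightarrow> 'v list \<Rightarrow> 'e list \<Rightarrow> bool" where
  "is_cycle G vs es \<longleftrightarrow> es \<noteq> [] \<and> length vs = length es \<and> distinct vs \<and> distinct es \<and>
     set vs \<subseteq> verts G \<and> set es \<subseteq> edges G \<and>
     (\<forall>i < length es. ends G (es ! i) = {vs ! i, vs ! (Suc i mod length es)})"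

text \<open>The independent sets of the cycle matroid of \<open>G\<close>.\<close>

definition indep :: "('v, 'e) multigraph \<Rightarrow> 'e set \<Rightarrow> bool" where
  "indep G I \<longleftrightarrow> I \<subseteq> edges G \<and> \<not> (\<exists>vs es. is_cycle G vs es \<and> set es \<subseteq> I)"

definition rk :: "('v, 'e) multigraph \<Rightarrow> 'e set \<Rightarrow> nat" where
  "rk G A = Max (card ` {I. I \<subseteq> A \<and> indep G I})"

text \<open>The subtraction below does not truncate, since \<open>rk G A \<le> card A\<close> for finite \<open>A\<close>.\<close>

definition nullity :: "('v, 'e) multigraph \<Rightarrow> 'e set \<Rightarrow> nat" where
  "nullity G A = card A - rk G A"

text \<open>Crapo's invariant of the cycle matroid restricted to \<open>A\<close>; the rank of \<open>B \<subseteq> A\<close> in the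
  restriction is its rank in the whole matroid.\<close>

definition crapo_beta :: "('v, 'e) multigraph \<Rightarrow> 'e set \<Rightarrow> int" where
  "crapo_beta G A = (- 1) ^ rk G A * (\<Sum>B \<in> Pow A. (- 1) ^ card B * int (rk G B))"

end

theory Submission imports Defs begin

text \<open>
  Up to the sign \<open>(-1)^|A|\<close>, the signed invariant \<open>(-1)^\<ell>(A) \<beta>(A)\<close> is the alternating sum
  \<open>alt_rk\<close> of the rank over the subsets of \<open>A\<close>. So the weights \<open>w(A) = (-1)^\<ell>(A) \<beta>(A)\<close> are the
  Moebius inverse of the rank: summing them over all subsets of an edge set \<open>F\<close> gives \<open>rk(F)\<close>
  (\<open>rk_eq_sum_alt_rk\<close>). The proof rewrites the factor \<open>binom(rk(A), k)\<close> until the sum over \<open>A\<close>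
  consists of such sums.

  The weight \<open>w(A)\<close> vanishes unless the edges of \<open>A\<close> lie in one connected piece: if the edges \<open>e\<close>
  and \<open>f\<close> of \<open>A\<close> lie in different pieces, then whether \<open>e\<close> increases the rank of a subset does not
  depend on the presence of \<open>f\<close>, and the terms cancel (\<open>alt_rk_eq_0\<close>). Hence, wherever the weight
  matters, \<open>rk(A) = |W| - 1\<close> for the set \<open>W\<close> of vertices covered by \<open>A\<close> (\<open>rk_support\<close>), and the
  partial alternating row sum of binomial coefficients gives
  \<open>(-1)^k binom(|W| - 1, k) = \<Sum> (-1)^|S|\<close> over all \<open>S \<subseteq> W\<close> with \<open>|S| \<le> k\<close>
  (\<open>sum_small_subsets_alternating\<close>).

  After exchanging the two sums, a vertex set \<open>S\<close> with \<open>|S| \<le> k\<close> contributes the total weight of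
  the edge sets that cover \<open>S\<close>. By inclusion-exclusion over the subsets \<open>T\<close> of \<open>S\<close> to be avoided,
  and by Moebius inversion, this weight is \<open>\<Sum> (-1)^|T| rk(E(G - T))\<close> over \<open>T \<subseteq> S\<close>
  (\<open>sum_covering_edge_sets\<close>). The rank of the cycle matroid is the number of vertices minus the
  number of components (\<open>rk_plus_components\<close>), and by \<open>k\<close>-connectivity \<open>G - T\<close> is connected for
  \<open>|T| < k\<close>. So \<open>rk(E(G - T)) = n - 1 - |T|\<close> where \<open>n\<close> is the number of vertices, with the
  correction \<open>|\<pi>\<^sub>0(G - T)| - 1\<close> to be subtracted only when \<open>|T| = k\<close>, that is, when \<open>T = S\<close> and
  \<open>|S| = k\<close>. In that case the signs \<open>(-1)^|S|\<close> and \<open>(-1)^|T|\<close> cancel, so the subtracted corrections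
  add up to the negated sum on the right-hand side. The main part, linear in
  \<open>|T|\<close>, has vanishing alternating sum over the subsets of \<open>S\<close> except when \<open>|S| \<le> 1\<close>; the empty
  set gives \<open>n - 1\<close>, the \<open>n\<close> singletons give \<open>-1\<close> each, and the total is \<open>-1\<close>. Since the
  prefactor is \<open>(-1)^(k+1) = - (-1)^k\<close>, both parts change their sign once more.
\<close>

section \<open>Walks and connected components\<close>

text \<open>Reachability by walks whose edges lie in \<open>A\<close>, on the whole vertex type: a walk of length
  zero is allowed at any point, and the restriction to \<open>verts G\<close> is made in \<open>linked\<close>. This avoids
  side conditions on vertices in the laws below.\<close>

definition reach :: "('v, 'e) multigraph \<Rightarrow> 'e set \<Rightarrow> ('v \<times> 'v) set" where
  "reach G A = (adjacency (G\<lparr>edges := A\<rparr>))\<^sup>*"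

lemma adjacency_insert:
  assumes "ends G e = {u, v}"
  shows "adjacency (G\<lparr>edges := insert e A\<rparr>) =
    insert (u, v) (insert (v, u) (adjacency (G\<lparr>edges := A\<rparr>)))"
  using assms by (auto simp: adjacency_def doubleton_eq_iff)

lemma reach_refl [simp]: "(x, x) \<in> reach G A"
  by (simp add: reach_def)

lemma sym_reach: "sym (reach G A)"
  unfolding reach_def by (rule sym_rtrancl) (auto simp: sym_def adjacency_def insert_commute)

lemma reach_sym: "(x, y) \<in> reach G A \<Longrightarrow> (y, x) \<in> reach G A"
  using sym_reach by (metis symD)

lemma reach_trans: "(x, y) \<in> reach G A \<Longrightarrow> (y, z) \<in> reach G A \<Longrightarrow> (x, z) \<in> reach G A"
  unfolding reach_def by (rule rtrancl_trans)

lemma reach_mono: "A \<subseteq> B \<Longrightarrow> reach G A \<subseteq> reach G B"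
  unfolding reach_def by (rule rtrancl_mono) (auto simp: adjacency_def)

lemma reach_edge: "e \<in> A \<Longrightarrow> ends G e = {u, v} \<Longrightarrow> (u, v) \<in> reach G A"
  unfolding reach_def by (rule r_into_rtrancl) (auto simp: adjacency_def)

text \<open>A walk that uses \<open>e\<close> several times can be shortened so that it crosses \<open>e\<close> at most once, in
  one of the two directions.\<close>

lemma reach_insert:
  assumes "ends G e = {u, v}"
  shows "(x, y) \<in> reach G (insert e A) \<longleftrightarrow>
    (x, y) \<in> reach G A \<or> (x, u) \<in> reach G A \<and> (v, y) \<in> reach G A
      \<or> (x, v) \<in> reach G A \<and> (u, y) \<in> reach G A"
  unfolding reach_def adjacency_insert[OF assms] rtrancl_insert
  by (auto dest: rtrancl_trans)

lemma reach_insert_absorb: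
  assumes "ends G e = {u, v}" "(u, v) \<in> reach G A"
  shows "reach G (insert e A) = reach G A"
proof -
  have "(x, y) \<in> reach G (insert e A) \<longleftrightarrow> (x, y) \<in> reach G A" for x y
    unfolding reach_insert[OF assms(1)] using assms(2) by (meson reach_trans reach_sym)
  then show ?thesis by auto
qed

lemma equiv_linked: "equiv (verts G) (linked G)"
proof (rule equivI)
  show "sym (linked G)"
    using sym_reach[of G "edges G"] by (auto simp: linked_def reach_def sym_def)
qed (auto simp: linked_def refl_on_def trans_def intro: rtrancl_trans)

lemma linked_edges_update:
  "linked (G\<lparr>edges := A\<rparr>) = {(x, y). x \<in> verts G \<and> y \<in> verts G \<and> (x, y) \<in> reach G A}"
  by (simp add: linked_def reach_def)

text \<open>The enlarged relation has the same classes, except that those of \<open>u\<close> and \<open>v\<close> are replaced by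
  their union. It is the effect on connected components of joining \<open>u\<close> and \<open>v\<close> by an edge.\<close>

lemma card_quotient_merge:
  assumes R: "equiv V R" and V: "finite V" "u \<in> V" "v \<in> V" and uv: "(u, v) \<notin> R"
  shows "Suc (card (V // (R \<union> R `` {u} \<times> R `` {v} \<union> R `` {v} \<times> R `` {u}))) = card (V // R)"
    (is "Suc (card (V // ?R)) = _")
proof -
  let ?U = "R `` {u}" and ?W = "R `` {v}"
  have "sym R" "trans R" "refl_on V R" using R by (auto simp: equiv_def)
  note sym = symD[OF \<open>sym R\<close>] and trans = transD[OF \<open>trans R\<close>]
    and refl = refl_onD[OF \<open>refl_on V R\<close>]
  have image: "(R \<union> U \<times> W \<union> W \<times> U) `` {x} =
      R `` {x} \<union> (if x \<in> U then W else {}) \<union> (if x \<in> W then U else {})" for U W x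
    by (auto split: if_splits)
  have near: "?R `` {x} = ?U \<union> ?W" if "x \<in> ?U \<union> ?W" for x
  proof (cases "x \<in> ?U")
    case True
    then have "R `` {x} = ?U" using equiv_class_eq[OF R, of u x] by simp
    then show ?thesis unfolding image using True by simp blast
  next
    case False
    then have x: "x \<in> ?W" using that by simp
    then have "R `` {x} = ?W" using equiv_class_eq[OF R, of v x] by simp
    then show ?thesis unfolding image using False x by simp blast
  qed
  have far: "?R `` {x} = R `` {x}" if "x \<notin> ?U \<union> ?W" for x
    unfolding image using that by simp
  have "V // ?R = insert (?U \<union> ?W) (V // R - {?U, ?W})" (is "?l = ?r")
  proof
    show "?l \<subseteq> ?r"
    proof
      fix X assume "X \<in> ?l"
      then obtain x where x: "x \<in> V" "X = ?R `` {x}"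
        by (auto elim: quotientE)
      show "X \<in> ?r"
      proof (cases "x \<in> ?U \<union> ?W")
        case True
        then show ?thesis using near x by simp
      next
        case False
        then have "R `` {x} \<noteq> ?U" "R `` {x} \<noteq> ?W"
          using refl[OF x(1)] by auto
        then show ?thesis using far[OF False] x by (auto intro: quotientI)
      qed
    qed
    show "?r \<subseteq> ?l"
    proof
      fix X assume "X \<in> ?r"
      then consider "X = ?U \<union> ?W" | "X \<in> V // R" "X \<noteq> ?U" "X \<noteq> ?W" by blast
      then show "X \<in> ?l"
      proof cases
        case 1
        then have "X = ?R `` {u}" using near[of u] refl[OF V(2)] by simp
        then show ?thesis using V(2) by (auto intro: quotientI)
      next
        case 2
        then obtain x where x: "x \<in> V" "X = R `` {x}"
          by (auto elim: quotientE)
        have "x \<notin> ?U \<union> ?W"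
          using 2 x equiv_class_eq[OF R] by auto
        then show ?thesis using far x by (metis quotientI)
      qed
    qed
  qed
  moreover have "?U \<union> ?W \<notin> V // R"
  proof
    assume "?U \<union> ?W \<in> V // R"
    then obtain x where "?U \<union> ?W = R `` {x}" by (auto elim: quotientE)
    then have "(x, u) \<in> R" "(x, v) \<in> R" using refl V by auto
    then show False using uv by (meson sym trans)
  qed
  moreover have "finite (V // R)"
    using R V by (meson equiv_type finite_quotient)
  moreover have "?U \<in> V // R" "?W \<in> V // R" using V by (auto intro: quotientI)
  moreover have "?U \<noteq> ?W" using uv refl V by auto
  moreover have "card {?U, ?W} \<le> card (V // R)"
    using calculation by (intro card_mono) auto
  ultimately show ?thesis
    by (simp add: card_Diff_subset)
qed

lemma card_components_insert:
  assumes "finite (verts G)" "ends G e = {u, v}" "{u, v} \<subseteq> verts G" "(u, v) \<notin> reach G A"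
  shows "Suc (card (components (G\<lparr>edges := insert e A\<rparr>))) = card (components (G\<lparr>edges := A\<rparr>))"
proof -
  let ?R = "linked (G\<lparr>edges := A\<rparr>)"
  have "linked (G\<lparr>edges := insert e A\<rparr>) =
      ?R \<union> ?R `` {u} \<times> ?R `` {v} \<union> ?R `` {v} \<times> ?R `` {u}"
    using assms(3) unfolding linked_edges_update reach_insert[OF assms(2)]
    by (auto dest: reach_sym)
  then show ?thesis
    using card_quotient_merge[of "verts G" ?R u v] equiv_linked[of "G\<lparr>edges := A\<rparr>"] assms
    by (simp add: components_def linked_edges_update)
qed

section \<open>The rank of the cycle matroid\<close>

text \<open>Induction along the walk: whenever the next vertex already lies on the path built so far, the
  path is cut back to that vertex.\<close>

lemma simple_path:
  assumes "(u, v) \<in> reach G A"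
  obtains vs es where "vs \<noteq> []" "hd vs = u" "last vs = v" "length vs = Suc (length es)"
    "distinct vs" "set es \<subseteq> A" "\<And>i. i < length es \<Longrightarrow> ends G (es ! i) = {vs ! i, vs ! Suc i}"
proof -
  define path where "path v vs es \<longleftrightarrow> vs \<noteq> [] \<and> hd vs = u \<and> last vs = v \<and>
    length vs = Suc (length es) \<and> distinct vs \<and> set es \<subseteq> A \<and>
    (\<forall>i < length es. ends G (es ! i) = {vs ! i, vs ! Suc i})" for v vs es
  have "\<exists>vs es. path v vs es"
    using assms unfolding reach_def
  proof (induction rule: rtrancl_induct)
    case base
    show ?case by (rule exI[of _ "[u]"], rule exI[of _ "[]"]) (simp add: path_def)
  next
    case (step y z)
    then obtain vs es where p: "path y vs es" by blast
    obtain e where e: "e \<in> A" "ends G e = {y, z}"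
      using step by (auto simp: adjacency_def)
    show ?case
    proof (cases "z \<in> set vs")
      case True
      then obtain j where j: "j < length vs" "vs ! j = z" by (auto simp: in_set_conv_nth)
      have "path z (take (Suc j) vs) (take j es)"
        using p j unfolding path_def
        by (auto simp: hd_conv_nth last_conv_nth dest: in_set_takeD)
      then show ?thesis by blast
    next
      case False
      have "path z (vs @ [z]) (es @ [e])"
        using p e False unfolding path_def
        by (auto simp: nth_append last_conv_nth less_Suc_eq)
      then show ?thesis by blast
    qed
  qed
  then show ?thesis using that by (auto simp: path_def)
qed

text \<open>The rest of the cycle is a walk between the ends of \<open>e\<close>. It starts after \<open>e\<close> and goes once
  around.\<close>

lemma reach_rest_of_cycle:
  assumes "is_cycle G vs es" "e \<in> set es" "ends G e = {u, v}"
  shows "(u, v) \<in> reach G (set es - {e})"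
proof -
  define m where "m = length es"
  obtain i where i: "i < m" "es ! i = e"
    using assms(2) by (auto simp: in_set_conv_nth m_def)
  have c: "distinct es" "\<And>j. j < m \<Longrightarrow> ends G (es ! j) = {vs ! j, vs ! (Suc j mod m)}"
    using assms(1) by (auto simp: is_cycle_def m_def)
  have "(vs ! (Suc i mod m), vs ! ((Suc i + t) mod m)) \<in> reach G (set es - {e})" if "t < m" for t
    using that
  proof (induction t)
    case (Suc t)
    let ?j = "(Suc i + t) mod m"
    have j: "?j < m" using i by simp
    have "?j \<noteq> i"
    proof
      assume "?j = i"
      then have "m dvd (i + Suc t) - i" using i(1) by (metis add_Suc_shift dvd_minus_mod)
      then show False using Suc.prems by (auto dest: dvd_imp_le)
    qed
    then have "es ! ?j \<in> set es - {e}"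
      using i j c(1) by (auto simp: m_def nth_eq_iff_index_eq)
    moreover have "Suc ?j mod m = (Suc i + Suc t) mod m" by (simp add: mod_Suc_eq)
    ultimately have "(vs ! ?j, vs ! ((Suc i + Suc t) mod m)) \<in> reach G (set es - {e})"
      using c(2)[OF j] by (metis reach_edge)
    then show ?case using Suc by (meson Suc_lessD reach_trans)
  qed simp
  from this[of "m - 1"] have "(vs ! (Suc i mod m), vs ! i) \<in> reach G (set es - {e})"
    using i by simp
  moreover have "{u, v} = {vs ! i, vs ! (Suc i mod m)}"
    using assms(3) c(2)[OF i(1)] i(2) by simp
  ultimately show ?thesis by (metis doubleton_eq_iff reach_sym)
qed

lemma edge_ends:
  assumes "finite_multigraph G" "e \<in> edges G"
  obtains u v where "ends G e = {u, v}" "{u, v} \<subseteq> verts G"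
  using assms unfolding finite_multigraph_def card_1_singleton_iff card_2_iff One_nat_def
  by (metis insert_absorb2)

lemma indep_subset: "indep G I \<Longrightarrow> J \<subseteq> I \<Longrightarrow> indep G J"
  unfolding indep_def by blast

text \<open>A cycle through \<open>e\<close> is the same as \<open>e\<close> together with a path of \<open>I\<close> between the ends of \<open>e\<close>.
  A self-loop is the case of the path of length zero.\<close>

lemma indep_insert_iff:
  assumes G: "finite_multigraph G" and e: "e \<in> edges G" "e \<notin> I" "ends G e = {u, v}"
    and I: "indep G I"
  shows "indep G (insert e I) \<longleftrightarrow> (u, v) \<notin> reach G I"
proof
  assume ind: "indep G (insert e I)"
  show "(u, v) \<notin> reach G I"
  proof
    assume "(u, v) \<in> reach G I"
    then obtain vs es where p: "vs \<noteq> []" "hd vs = u" "last vs = v" "length vs = Suc (length es)"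
      "distinct vs" "set es \<subseteq> I" "\<And>i. i < length es \<Longrightarrow> ends G (es ! i) = {vs ! i, vs ! Suc i}"
      by (rule simple_path) blast
    \<comment> \<open>Along a simple path different steps have different pairs of ends, so no edge is repeated.\<close>
    have "distinct es"
      unfolding distinct_conv_nth
    proof (intro allI impI)
      fix i j assume ij: "i < length es" "j < length es" "i \<noteq> j"
      have "{vs ! i, vs ! Suc i} \<noteq> {vs ! j, vs ! Suc j}"
        using ij p(4,5) by (auto simp: doubleton_eq_iff nth_eq_iff_index_eq)
      then show "es ! i \<noteq> es ! j" using p(7) ij by metis
    qed
    have ends: "ends G ((es @ [e]) ! i) = {vs ! i, vs ! (Suc i mod length (es @ [e]))}"
      if "i < length (es @ [e])" for i
    proof (cases "i < length es")
      case True
      then show ?thesis using p(7) by (simp add: nth_append)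
    next
      case False
      then have "i = length es" using that by simp
      then show ?thesis
        using p(1-4) e(3) by (simp add: nth_append hd_conv_nth last_conv_nth insert_commute)
    qed
    have I_edges: "set es \<subseteq> edges G" using p(6) I by (auto simp: indep_def)
    have "set vs \<subseteq> verts G"
    proof
      fix x assume "x \<in> set vs"
      then obtain i where i: "i < length (es @ [e])" "x = vs ! i"
        using p(4) by (auto simp: in_set_conv_nth)
      then have "x \<in> ends G ((es @ [e]) ! i)" using ends by simp
      moreover have "(es @ [e]) ! i \<in> edges G"
        using nth_mem[OF i(1)] I_edges e(1) by auto
      ultimately show "x \<in> verts G" using G by (auto simp: finite_multigraph_def)
    qed
    then have "is_cycle G vs (es @ [e])"
      unfolding is_cycle_def using p \<open>distinct es\<close> I_edges e ends by auto
    then show False using ind p(6) unfolding indep_def by fastforce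
  qed
next
  assume not: "(u, v) \<notin> reach G I"
  show "indep G (insert e I)"
    unfolding indep_def
  proof (intro conjI notI)
    show "insert e I \<subseteq> edges G" using e I by (auto simp: indep_def)
    assume "\<exists>vs es. is_cycle G vs es \<and> set es \<subseteq> insert e I"
    then obtain vs es where c: "is_cycle G vs es" "set es \<subseteq> insert e I" by blast
    then have "e \<in> set es" using I unfolding indep_def by blast
    from reach_rest_of_cycle[OF c(1) this e(3)] show False
      using not c(2) reach_mono[of "set es - {e}" I G] by blast
  qed
qed

text \<open>Building the forest edge by edge never closes a cycle, so each new edge merges two components
  and their number drops by one.\<close>

lemma card_indep:
  assumes G: "finite_multigraph G" and I: "indep G I"
  shows "card I + card (components (G\<lparr>edges := I\<rparr>)) = card (verts G)"
proof -
  have "finite I" using assms by (auto simp: finite_multigraph_def indep_def intro: finite_subset)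
  then show ?thesis using I
  proof induction
    case empty
    have "reach G {} = Id" by (simp add: reach_def adjacency_def)
    then have "linked (G\<lparr>edges := {}\<rparr>) = Id_on (verts G)"
      by (auto simp: linked_edges_update)
    then have "components (G\<lparr>edges := {}\<rparr>) = (\<lambda>x. {x}) ` verts G"
      by (auto simp: components_def quotient_def Id_on_def)
    then show ?case by (simp add: card_image)
  next
    case (insert e I)
    then have e: "e \<in> edges G" by (simp add: indep_def)
    have ind: "indep G I" using insert.prems by (rule indep_subset) blast
    obtain u v where uv: "ends G e = {u, v}" "{u, v} \<subseteq> verts G" using edge_ends[OF G e] .
    have "(u, v) \<notin> reach G I"
      using indep_insert_iff[OF G e _ uv(1) ind] insert by simp
    then have "Suc (card (components (G\<lparr>edges := insert e I\<rparr>))) = card (components (G\<lparr>edges := I\<rparr>))"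
      using card_components_insert[OF _ uv] G by (simp add: finite_multigraph_def)
    then show ?case using insert ind by simp
  qed
qed

text \<open>Go through the edges of \<open>A\<close> and add exactly those that join two different components.\<close>

lemma indep_extends_to_spanning_forest:
  assumes G: "finite_multigraph G" and J: "indep G J" and A: "A \<subseteq> edges G"
  shows "\<exists>I. J \<subseteq> I \<and> I \<subseteq> J \<union> A \<and> indep G I \<and> reach G I = reach G (J \<union> A)"
proof -
  have "finite A" using assms by (auto simp: finite_multigraph_def intro: finite_subset)
  then show ?thesis using A
  proof induction
    case empty
    show ?case using J by auto
  next
    case (insert e A)
    then have A: "A \<subseteq> edges G" and e: "e \<in> edges G" by auto
    then obtain I where I: "J \<subseteq> I" "I \<subseteq> J \<union> A" "indep G I" "reach G I = reach G (J \<union> A)"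
      using insert.IH[OF A] by blast
    obtain u v where uv: "ends G e = {u, v}" by (rule edge_ends[OF G e])
    show ?case
    proof (cases "(u, v) \<in> reach G (J \<union> A)")
      case True
      then have "reach G (J \<union> insert e A) = reach G I"
        using reach_insert_absorb[OF uv] I(4) by simp
      moreover have "I \<subseteq> J \<union> insert e A" using I(2) by blast
      ultimately show ?thesis using I(1,3) by metis
    next
      case False
      then have "(u, v) \<notin> reach G I" using I(4) by simp
      moreover from this have "e \<notin> I" using reach_edge[of e I G u v] uv by blast
      ultimately have "indep G (insert e I)"
        using indep_insert_iff[OF G e _ uv I(3)] by simp
      moreover have "reach G (insert e I) = reach G (J \<union> insert e A)"
        using I(4) reach_insert[OF uv] by auto
      ultimately show ?thesis using I(1,2) by (intro exI[of _ "insert e I"]) auto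
    qed
  qed
qed

lemma components_reach: "reach G A = reach G B \<Longrightarrow>
  components (G\<lparr>edges := A\<rparr>) = components (G\<lparr>edges := B\<rparr>)"
  by (simp add: components_def linked_edges_update)

text \<open>All spanning forests of \<open>A\<close> have the same number of edges, as they have the same components
  as \<open>A\<close>, and every independent subset of \<open>A\<close> extends to one of them.\<close>

theorem rk_plus_components:
  assumes G: "finite_multigraph G" and A: "A \<subseteq> edges G"
  shows "rk G A + card (components (G\<lparr>edges := A\<rparr>)) = card (verts G)"
proof -
  have "finite A" using assms by (auto simp: finite_multigraph_def intro: finite_subset)
  have extend: "\<exists>K. J \<subseteq> K \<and> K \<subseteq> A \<and> indep G K \<and>
      card K + card (components (G\<lparr>edges := A\<rparr>)) = card (verts G)"
    if J: "J \<subseteq> A" "indep G J" for J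
  proof -
    obtain K where K: "J \<subseteq> K" "K \<subseteq> J \<union> A" "indep G K" "reach G K = reach G (J \<union> A)"
      using indep_extends_to_spanning_forest[OF G J(2) A] by blast
    then show ?thesis
      using card_indep[OF G K(3)] components_reach[OF K(4)] J(1) K(1,2) by (auto simp: Un_absorb1)
  qed
  have "indep G {}" by (auto simp: indep_def is_cycle_def)
  then obtain I where I: "I \<subseteq> A" "indep G I"
      "card I + card (components (G\<lparr>edges := A\<rparr>)) = card (verts G)"
    using extend[of "{}"] by (metis empty_subsetI)
  have "card J \<le> card I" if "J \<subseteq> A" "indep G J" for J
  proof -
    obtain K where K: "J \<subseteq> K" "K \<subseteq> A"
        "card K + card (components (G\<lparr>edges := A\<rparr>)) = card (verts G)"
      using extend[OF \<open>J \<subseteq> A\<close> \<open>indep G J\<close>] by metis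
    then have "card J \<le> card K" using \<open>finite A\<close> by (intro card_mono finite_subset[of K A])
    then show ?thesis using K(3) I(3) by simp
  qed
  then have "rk G A = card I"
    unfolding rk_def using \<open>finite A\<close> I by (intro Max_eqI) auto
  then show ?thesis using I(3) by simp
qed


lemma rk_insert:
  assumes G: "finite_multigraph G" and e: "insert e A \<subseteq> edges G" "ends G e = {u, v}"
  shows "rk G (insert e A) = rk G A + (if (u, v) \<in> reach G A then 0 else 1)"
proof -
  have "e \<in> edges G" "A \<subseteq> edges G" using e by auto
  then have "finite (verts G)" "{u, v} \<subseteq> verts G"
    using G e(2) by (auto simp: finite_multigraph_def)
  then show ?thesis
    using rk_plus_components[OF G e(1)] rk_plus_components[OF G \<open>A \<subseteq> edges G\<close>]
      card_components_insert[of G e u v A] e(2)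
      components_reach[OF reach_insert_absorb[of G e u v A]]
    by (auto split: if_splits)
qed

lemma rk_le_card: "finite A \<Longrightarrow> rk G A \<le> card A"
proof -
  assume "finite A"
  moreover have "indep G {}" by (auto simp: indep_def is_cycle_def)
  ultimately show ?thesis unfolding rk_def by (subst Max_le_iff) (auto intro: card_mono)
qed

lemma is_cycle_cong_verts:
  assumes c: "is_cycle G vs es" "set es \<subseteq> edges H" "ends H = ends G"
    and "\<And>e. e \<in> set es \<Longrightarrow> ends G e \<subseteq> verts H"
  shows "is_cycle H vs es"
proof -
  have "set vs \<subseteq> verts H"
  proof
    fix x assume "x \<in> set vs"
    then obtain i where i: "i < length es" "x = vs ! i"
      using c(1) by (auto simp: in_set_conv_nth is_cycle_def)
    then have "x \<in> ends G (es ! i)" using c(1) by (simp add: is_cycle_def)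
    then show "x \<in> verts H" using assms(4)[of "es ! i"] i(1) by auto
  qed
  then show ?thesis using c unfolding is_cycle_def by auto
qed

text \<open>Every vertex of a cycle is an end of one of its edges, so independence does not depend on the
  vertex set in which the edges are considered. This lets the rank formula be applied to
  \<open>delete_verts G S\<close> and to the subgraph of the vertices covered by an edge set.\<close>

lemma rk_cong_verts:
  assumes "ends H = ends G" "A \<subseteq> edges G" "A \<subseteq> edges H"
    and "\<And>e. e \<in> A \<Longrightarrow> ends G e \<subseteq> verts G \<inter> verts H"
  shows "rk H A = rk G A"
proof -
  have "indep H I \<longleftrightarrow> indep G I" if I: "I \<subseteq> A" for I
  proof -
    have "is_cycle H vs es \<longleftrightarrow> is_cycle G vs es" if "set es \<subseteq> I" for vs es
    proof -
      have "set es \<subseteq> A" using that I by blast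
      then show ?thesis
        using is_cycle_cong_verts[of H vs es G] is_cycle_cong_verts[of G vs es H] assms
        by (metis le_inf_iff subset_iff)
    qed
    then show ?thesis using I assms unfolding indep_def by blast
  qed
  then have "{I. I \<subseteq> A \<and> indep H I} = {I. I \<subseteq> A \<and> indep G I}" by blast
  then show ?thesis by (simp add: rk_def)
qed

lemma finite_multigraph_delete_verts:
  "finite_multigraph G \<Longrightarrow> finite_multigraph (delete_verts G S)"
  by (auto simp: finite_multigraph_def delete_verts_def)

lemma rk_delete_verts:
  assumes "finite_multigraph G"
  shows "rk G (edges (delete_verts G S)) + card (components (delete_verts G S)) =
    card (verts G - S)"
proof -
  let ?H = "delete_verts G S"
  have "?H\<lparr>edges := edges ?H\<rparr> = ?H" by simp
  then have "rk ?H (edges ?H) + card (components ?H) = card (verts ?H)"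
    using rk_plus_components[OF finite_multigraph_delete_verts[OF assms], of "edges ?H" S] by simp
  moreover have "rk ?H (edges ?H) = rk G (edges ?H)"
    by (rule rk_cong_verts) (use assms in \<open>auto simp: delete_verts_def finite_multigraph_def\<close>)
  ultimately show ?thesis by (simp add: delete_verts_def)
qed

lemma card_components_connected:
  assumes "connected_graph G"
  shows "card (components G) = 1"
proof -
  obtain x where x: "x \<in> verts G" using assms by (auto simp: connected_graph_def)
  have "linked G `` {y} = verts G" if "y \<in> verts G" for y
    using assms that by (auto simp: connected_graph_def linked_def)
  then have "components G = {verts G}"
    using x by (auto simp: components_def quotient_def)
  then show ?thesis by simp
qed

lemma rk_connected_edge_set:
  assumes G: "finite_multigraph G" and A: "A \<subseteq> edges G" "A \<noteq> {}"
    and linked: "\<And>x y. x \<in> \<Union>(ends G ` A) \<Longrightarrow> y \<in> \<Union>(ends G ` A) \<Longrightarrow> (x, y) \<in> reach G A"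
  shows "Suc (rk G A) = card (\<Union>(ends G ` A))"
proof -
  define H where "H = \<lparr>verts = \<Union>(ends G ` A), edges = A, ends = ends G\<rparr>"
  have fin: "finite_multigraph H"
    using G A unfolding finite_multigraph_def H_def
    by (auto intro: finite_subset[of A] finite_subset[of _ "verts G"])
  have "ends G e \<noteq> {}" if "e \<in> A" for e
    using edge_ends[OF G] A(1) that by (metis insert_not_empty subsetD)
  then have "verts H \<noteq> {}" using A(2) by (auto simp: H_def)
  then have "connected_graph H"
    using linked by (auto simp: connected_graph_def H_def linked_def reach_def adjacency_def)
  then have "Suc (rk H A) = card (verts H)"
    using rk_plus_components[OF fin, of A] card_components_connected[of H] by (simp add: H_def)
  moreover have "rk H A = rk G A"
    by (rule rk_cong_verts) (use G A in \<open>auto simp: H_def finite_multigraph_def\<close>)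
  ultimately show ?thesis by (simp add: H_def)
qed

section \<open>Alternating sums over subsets\<close>

lemma sum_Pow_split:
  fixes h :: "'a set \<Rightarrow> int"
  assumes "finite A" "x \<in> A"
  shows "(\<Sum>B \<in> Pow A. h B) = (\<Sum>B \<in> Pow (A - {x}). h B + h (insert x B))"
proof -
  have "Pow A = Pow (A - {x}) \<union> insert x ` Pow (A - {x})"
    using assms(2) Pow_insert[of x "A - {x}"] by (simp add: insert_absorb)
  moreover have "inj_on (insert x) (Pow (A - {x}))" by (auto simp: inj_on_def)
  ultimately show ?thesis
    using assms(1) by (simp add: sum.union_disjoint sum.reindex sum.distrib disjoint_iff)
      (subst sum.union_disjoint; auto simp: sum.reindex)
qed

lemma card_insert_Pow_remove:
  "finite A \<Longrightarrow> B \<in> Pow (A - {x}) \<Longrightarrow> card (insert x B) = Suc (card B)"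
  by (subst card_insert_disjoint) (auto intro: finite_subset)

lemma sum_Pow_alternating:
  "finite S \<Longrightarrow> (\<Sum>T \<in> Pow S. (- 1) ^ card T) = (if S = {} then 1 else 0 :: int)"
proof (cases "S = {}")
  case False
  moreover assume "finite S"
  moreover obtain x where "x \<in> S" using False by blast
  ultimately show ?thesis
    by (simp add: sum_Pow_split[of S x] card_insert_Pow_remove)
qed simp

text \<open>Such a sum is an iterated difference, of order \<open>card S\<close>, of a linear function. Its first
  difference is constant and its second difference is zero.\<close>

lemma sum_Pow_alternating_linear:
  fixes N :: int
  assumes "finite S"
  shows "(\<Sum>T \<in> Pow S. (- 1) ^ card T * (N - int (card T))) =
    (if S = {} then N else if card S = 1 then 1 else 0)"
proof (cases "S = {}")
  case False
  then obtain x where x: "x \<in> S" by blast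
  have "(\<Sum>T \<in> Pow S. (- 1) ^ card T * (N - int (card T))) = (\<Sum>T \<in> Pow (S - {x}). (- 1) ^ card T)"
    unfolding sum_Pow_split[OF assms x]
    by (rule sum.cong) (simp_all add: card_insert_Pow_remove[OF assms] algebra_simps)
  also have "\<dots> = (if S - {x} = {} then 1 else 0)"
    using sum_Pow_alternating assms by blast
  also have "S - {x} = {} \<longleftrightarrow> card S = 1"
    using x assms by (metis Diff_eq_empty_iff card_1_singleton_iff One_nat_def Diff_cancel
        empty_iff insert_iff singletonD subset_singletonD)
  finally show ?thesis using False by simp
qed simp

text \<open>Grouped by cardinality, the left-hand side is an alternating partial row sum of Pascal's
  triangle, which telescopes.\<close>

lemma sum_small_subsets_alternating:
  assumes "finite W" "W \<noteq> {}"
  shows "(\<Sum>S | S \<subseteq> W \<and> card S \<le> k. (- 1) ^ card S) = (- 1) ^ k * int (card W - 1 choose k)"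
proof (induction k)
  case 0
  have "{S. S \<subseteq> W \<and> card S \<le> 0} = {{}}"
    using assms by (auto dest: finite_subset)
  then show ?case by simp
next
  case (Suc k)
  obtain m where m: "card W = Suc m" using assms by (metis card_gt_0_iff gr0_implies_Suc)
  have "{S. S \<subseteq> W \<and> card S \<le> Suc k} =
      {S. S \<subseteq> W \<and> card S \<le> k} \<union> {S. S \<subseteq> W \<and> card S = Suc k}" by auto
  then have "(\<Sum>S | S \<subseteq> W \<and> card S \<le> Suc k. (- 1) ^ card S :: int) =
      (\<Sum>S | S \<subseteq> W \<and> card S \<le> k. (- 1) ^ card S) + (\<Sum>S | S \<subseteq> W \<and> card S = Suc k. (- 1) ^ card S)"
    using assms(1) by (simp only:) (subst sum.union_disjoint; auto)
  also have "(\<Sum>S | S \<subseteq> W \<and> card S = Suc k. (- 1) ^ card S) =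
      (\<Sum>S | S \<subseteq> W \<and> card S = Suc k. (- 1) ^ Suc k :: int)"
    by (rule sum.cong) auto
  also have "\<dots> = (- 1) ^ Suc k * int (Suc m choose Suc k)"
    using n_subsets[OF assms(1), of "Suc k"] m by simp
  finally show ?case using Suc.IH m by (simp add: algebra_simps)
qed

section \<open>The signed beta invariant as Moebius inverse of the rank\<close>

definition alt_rk :: "('v, 'e) multigraph \<Rightarrow> 'e set \<Rightarrow> int" where
  "alt_rk G A = (\<Sum>B \<in> Pow A. (- 1) ^ card B * int (rk G B))"

lemma signed_beta:
  assumes "finite A"
  shows "(- 1) ^ nullity G A * crapo_beta G A = (- 1) ^ card A * alt_rk G A"
proof -
  have "nullity G A + rk G A = card A" using rk_le_card[OF assms, of G] by (simp add: nullity_def)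
  then show ?thesis by (simp add: crapo_beta_def alt_rk_def flip: mult.assoc power_add)
qed

lemma rk_eq_sum_alt_rk:
  assumes "finite A"
  shows "int (rk G A) = (\<Sum>B \<in> Pow A. (- 1) ^ card B * alt_rk G B)"
  by (rule inclusion_exclusion_symmetric[OF _ assms]) (simp add: alt_rk_def)

text \<open>The alternating sum is, up to sign, the alternating sum over \<open>B\<close> of the rank gained by adding
  \<open>e\<close> to \<open>B\<close>. This gain is 0 or 1 according to whether the ends of \<open>e\<close> are linked in \<open>B\<close>. An edge
  \<open>f\<close> in another component of \<open>A\<close> does not change it, so the terms of \<open>B\<close> and \<open>insert f B\<close>
  cancel.\<close>

lemma alt_rk_eq_0:
  assumes G: "finite_multigraph G" and A: "A \<subseteq> edges G" and e: "e \<in> A" "f \<in> A"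
    and xy: "x \<in> ends G e" "y \<in> ends G f" "(x, y) \<notin> reach G A"
  shows "alt_rk G A = 0"
proof -
  have fin: "finite A" using G A by (auto simp: finite_multigraph_def intro: finite_subset)
  have "e \<in> edges G" "f \<in> edges G" using e A by auto
  obtain u v where uv: "ends G e = {u, v}" by (rule edge_ends[OF G \<open>e \<in> edges G\<close>])
  obtain a b where ab: "ends G f = {a, b}" by (rule edge_ends[OF G \<open>f \<in> edges G\<close>])
  have apart: "(p, q) \<notin> reach G A" if "p \<in> {u, v}" "q \<in> {a, b}" for p q
  proof
    assume "(p, q) \<in> reach G A"
    moreover have "(x, p) \<in> reach G A"
      using that(1) xy(1) uv reach_edge[OF e(1) uv] by (auto intro: reach_sym)
    moreover have "(q, y) \<in> reach G A"
      using that(2) xy(2) ab reach_edge[OF e(2) ab] by (auto intro: reach_sym)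
    ultimately show False using xy(3) by (meson reach_trans)
  qed
  have "e \<noteq> f" using apart[of u a] apart[of u b] uv ab by (auto simp: doubleton_eq_iff)
  define m :: "'b set \<Rightarrow> int" where "m B = (if (u, v) \<in> reach G B then 0 else 1)" for B
  have gain: "int (rk G (insert e B)) = int (rk G B) + m B" if "B \<in> Pow (A - {e})" for B
  proof -
    have "insert e B \<subseteq> edges G" using that e(1) A by auto
    then show ?thesis using rk_insert[OF G _ uv, of B] by (simp add: m_def)
  qed
  have unaffected: "m (insert f B) = m B" if B: "B \<subseteq> A - {e} - {f}" for B
  proof -
    have "B \<subseteq> A" using B by blast
    have "(u, a) \<notin> reach G B" "(u, b) \<notin> reach G B"
      using apart reach_mono[OF \<open>B \<subseteq> A\<close>, of G] by auto
    then show ?thesis unfolding m_def reach_insert[OF ab] by simp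
  qed
  have "alt_rk G A = (\<Sum>B \<in> Pow (A - {e}). - ((- 1) ^ card B * m B))"
    unfolding alt_rk_def sum_Pow_split[OF fin e(1)]
    by (rule sum.cong) (simp_all add: card_insert_Pow_remove[OF fin] gain algebra_simps del: Pow_iff)
  also have "\<dots> = (\<Sum>B \<in> Pow (A - {e} - {f}). 0)"
    using fin e \<open>e \<noteq> f\<close>
    by (subst sum_Pow_split[of _ f], simp, simp, intro sum.cong)
      (auto simp: card_insert_Pow_remove[of "A - {e}"] unaffected)
  finally show ?thesis by simp
qed

lemma rk_support:
  assumes G: "finite_multigraph G" and A: "A \<subseteq> edges G" and nz: "alt_rk G A \<noteq> 0"
  shows "Suc (rk G A) = card (\<Union>(ends G ` A))"
proof (rule rk_connected_edge_set[OF G A])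
  show "A \<noteq> {}" using nz rk_le_card[of "{}" G] by (auto simp: alt_rk_def)
  show "(x, y) \<in> reach G A" if "x \<in> \<Union>(ends G ` A)" "y \<in> \<Union>(ends G ` A)" for x y
    using alt_rk_eq_0[OF G A] nz that by blast
qed

text \<open>The condition that \<open>A\<close> covers \<open>S\<close> is expanded by inclusion-exclusion over the sets \<open>T \<subseteq> S\<close>
  of vertices that \<open>A\<close> avoids. The edge sets that avoid \<open>T\<close> are all the subsets of the edge set of
  \<open>G - T\<close>, so that Moebius inversion turns their total weight into a rank.\<close>

lemma sum_covering_edge_sets:
  assumes G: "finite_multigraph G" and S: "finite S"
  shows "(\<Sum>A \<in> Pow (edges G). (- 1) ^ card A * alt_rk G A * (if S \<subseteq> \<Union>(ends G ` A) then 1 else 0)) =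
    (\<Sum>T \<in> Pow S. (- 1) ^ card T * int (rk G (edges (delete_verts G T))))"
proof -
  have E: "finite (edges G)" using G by (simp add: finite_multigraph_def)
  define w where "w A = (- 1) ^ card A * alt_rk G A" for A
  have indicator: "(if S \<subseteq> U then 1 else 0) =
      (\<Sum>T \<in> Pow S. (- 1) ^ card T * (if T \<inter> U = {} then 1 else 0 :: int))" for U
  proof -
    have "(\<Sum>T \<in> Pow S. (- 1) ^ card T * (if T \<inter> U = {} then 1 else 0 :: int)) =
        (\<Sum>T \<in> Pow (S - U). (- 1) ^ card T)"
      using S by (intro sum.mono_neutral_cong_right) auto
    also have "\<dots> = (if S - U = {} then 1 else 0)"
      using S sum_Pow_alternating[of "S - U"] by simp
    finally show ?thesis by (simp add: Diff_eq_empty_iff)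
  qed
  have avoid: "(\<Sum>A \<in> Pow (edges G). w A * (if T \<inter> \<Union>(ends G ` A) = {} then 1 else 0)) =
      int (rk G (edges (delete_verts G T)))" for T
  proof -
    have "(\<Sum>A \<in> Pow (edges G). w A * (if T \<inter> \<Union>(ends G ` A) = {} then 1 else 0)) =
        (\<Sum>A \<in> Pow (edges (delete_verts G T)). w A)"
      using E by (intro sum.mono_neutral_cong_right) (auto simp: delete_verts_def)
    also have "\<dots> = int (rk G (edges (delete_verts G T)))"
      unfolding w_def using E by (intro rk_eq_sum_alt_rk[symmetric]) (simp add: delete_verts_def)
    finally show ?thesis .
  qed
  have "(\<Sum>A \<in> Pow (edges G). w A * (if S \<subseteq> \<Union>(ends G ` A) then 1 else 0)) =
      (\<Sum>A \<in> Pow (edges G). \<Sum>T \<in> Pow S.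
        (- 1) ^ card T * (w A * (if T \<inter> \<Union>(ends G ` A) = {} then 1 else 0)))"
    unfolding indicator sum_distrib_left by (simp only: mult.left_commute)
  also have "\<dots> = (\<Sum>T \<in> Pow S. (- 1) ^ card T *
      (\<Sum>A \<in> Pow (edges G). w A * (if T \<inter> \<Union>(ends G ` A) = {} then 1 else 0)))"
    unfolding sum_distrib_left by (rule sum.swap)
  finally show ?thesis unfolding avoid unfolding w_def .
qed

section \<open>Small vertex sets in a \<open>k\<close>-connected graph\<close>

text \<open>For \<open>|T| < k\<close> the graph \<open>G - T\<close> is connected and the rank of its edge set is linear in \<open>|T|\<close>.
  Only \<open>T = S\<close> can have \<open>k\<close> elements and thus deviate from this.\<close>

lemma sum_alternating_rk_k_connected:
  assumes G: "finite_multigraph G" and conn: "k_connected k G"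
    and S: "S \<subseteq> verts G" "card S \<le> k"
  shows "(\<Sum>T \<in> Pow S. (- 1) ^ card T * int (rk G (edges (delete_verts G T)))) =
    (if S = {} then int (card (verts G)) - 1 else if card S = 1 then 1 else 0)
      - (if card S = k then (- 1) ^ k * (int (card (components (delete_verts G S))) - 1) else 0)"
proof -
  let ?c = "\<lambda>T. int (card (components (delete_verts G T)))"
  let ?N = "int (card (verts G)) - 1"
  have fin: "finite (verts G)" "finite S"
    using G S by (auto simp: finite_multigraph_def intro: finite_subset)
  have rank: "int (rk G (edges (delete_verts G T))) =
      (?N - int (card T)) - (if T = S then if card S = k then ?c S - 1 else 0 else 0)"
    if T: "T \<in> Pow S" for T
  proof -
    have "T \<subseteq> verts G" "finite T" using T S fin by (auto intro: finite_subset)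
    then have card: "card (verts G - T) = card (verts G) - card T" "card T \<le> card (verts G)"
      using fin by (auto intro: card_mono card_Diff_subset)
    have "card T \<le> card S" "T \<noteq> S \<Longrightarrow> card T < card S"
      using T fin by (auto intro: card_mono psubset_card_mono)
    moreover have "?c T = 1" if "card T < k"
      using conn T S(1) that card_components_connected[of "delete_verts G T"]
      by (auto simp: k_connected_def)
    moreover have "int (rk G (edges (delete_verts G T))) + ?c T = int (card (verts G)) - int (card T)"
      using rk_delete_verts[OF G, of T] card by linarith
    ultimately show ?thesis using S(2) by (cases "T = S") (simp_all, linarith)
  qed
  have "(\<Sum>T \<in> Pow S. (- 1) ^ card T * int (rk G (edges (delete_verts G T)))) =
      (\<Sum>T \<in> Pow S. (- 1) ^ card T * (?N - int (card T))
        - (if T = S then (- 1) ^ card T * (if card S = k then ?c S - 1 else 0) else 0))"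
    by (rule sum.cong[OF refl]) (unfold rank right_diff_distrib, simp)
  then show ?thesis
    using fin(2) by (simp add: sum_subtractf sum_Pow_alternating_linear)
qed

theorem theorem1p2:
  fixes G :: "('v, 'e) multigraph" and k :: nat
  assumes "k \<ge> 1"
    and "finite_multigraph G"
    and "k_connected k G"
    and "loopless G"
  shows "(- 1) ^ (k + 1) *
           (\<Sum>A \<in> Pow (edges G). (- 1) ^ nullity G A * crapo_beta G A * int (rk G A choose k)) =
         1 + (\<Sum>S \<in> {S. S \<subseteq> verts G \<and> card S = k}.
                int (card (components (delete_verts G S))) - 1)"
proof -
  let ?P = "{S. S \<subseteq> verts G \<and> card S \<le> k}"
  let ?c = "\<lambda>S. int (card (components (delete_verts G S)))"
  let ?n = "int (card (verts G))"
  define w where "w A = (- 1) ^ card A * alt_rk G A" for A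
  have fin: "finite (verts G)" "finite (edges G)" and P: "finite ?P"
    using assms(2) by (auto simp: finite_multigraph_def)
  \<comment> \<open>Only edge sets with \<open>rk(A) = |W| - 1\<close> have nonzero weight; for these the binomial
      coefficient is a signed count of the small subsets of \<open>W\<close>.\<close>
  have summand: "(- 1) ^ k * ((- 1) ^ nullity G A * crapo_beta G A * int (rk G A choose k)) =
      (\<Sum>S \<in> ?P. (- 1) ^ card S * (w A * (if S \<subseteq> \<Union>(ends G ` A) then 1 else 0)))"
    if A: "A \<in> Pow (edges G)" for A
  proof (cases "alt_rk G A = 0")
    case True
    then show ?thesis using signed_beta[of A G] A fin by (simp add: w_def finite_subset)
  next
    case False
    let ?W = "\<Union>(ends G ` A)"
    have W: "Suc (rk G A) = card ?W" using rk_support[OF assms(2) _ False] A by simp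
    then have "card ?W > 0" by linarith
    then have "finite ?W" "?W \<noteq> {}" unfolding card_gt_0_iff by blast+
    have "?W \<subseteq> verts G" using A assms(2) by (auto simp: finite_multigraph_def)
    then have "{S. S \<subseteq> ?W \<and> card S \<le> k} \<subseteq> ?P" by blast
    have "(- 1) ^ k * int (rk G A choose k) = (\<Sum>S | S \<subseteq> ?W \<and> card S \<le> k. (- 1) ^ card S)"
      using sum_small_subsets_alternating[OF \<open>finite ?W\<close> \<open>?W \<noteq> {}\<close>, of k] W
      by (metis diff_Suc_1)
    also have "\<dots> = (\<Sum>S \<in> ?P. (- 1) ^ card S * (if S \<subseteq> ?W then 1 else 0))"
      using P \<open>{S. S \<subseteq> ?W \<and> card S \<le> k} \<subseteq> ?P\<close> by (intro sum.mono_neutral_cong_left) auto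
    finally have "w A * ((- 1) ^ k * int (rk G A choose k)) =
        (\<Sum>S \<in> ?P. (- 1) ^ card S * (w A * (if S \<subseteq> ?W then 1 else 0)))"
      by (simp only: sum_distrib_left mult.left_commute)
    moreover have "w A = (- 1) ^ nullity G A * crapo_beta G A"
      using signed_beta[of A G] A fin by (simp add: w_def finite_subset)
    ultimately show ?thesis by (simp only: mult_ac)
  qed
  have "(- 1) ^ k * (\<Sum>A \<in> Pow (edges G). (- 1) ^ nullity G A * crapo_beta G A * int (rk G A choose k))
      = (\<Sum>A \<in> Pow (edges G). \<Sum>S \<in> ?P. (- 1) ^ card S * (w A * (if S \<subseteq> \<Union>(ends G ` A) then 1 else 0)))"
    unfolding sum_distrib_left by (rule sum.cong[OF refl summand])
  also have "\<dots> = (\<Sum>S \<in> ?P. (- 1) ^ card S *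
      (\<Sum>A \<in> Pow (edges G). w A * (if S \<subseteq> \<Union>(ends G ` A) then 1 else 0)))"
    unfolding sum_distrib_left by (rule sum.swap)
  also have "\<dots> = (\<Sum>S \<in> ?P.
      (- 1) ^ card S * (if S = {} then ?n - 1 else if card S = 1 then 1 else 0)
      - (if card S = k then ?c S - 1 else 0))"
  proof (rule sum.cong[OF refl])
    fix S assume S: "S \<in> ?P"
    then have "finite S" using fin by (auto intro: finite_subset)
    have "(\<Sum>A \<in> Pow (edges G). w A * (if S \<subseteq> \<Union>(ends G ` A) then 1 else 0)) =
      (if S = {} then ?n - 1 else if card S = 1 then 1 else 0)
        - (if card S = k then (- 1) ^ k * (?c S - 1) else 0)"
      unfolding w_def sum_covering_edge_sets[OF assms(2) \<open>finite S\<close>]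
      using S by (intro sum_alternating_rk_k_connected[OF assms(2,3)]) auto
    then show "(- 1) ^ card S * (\<Sum>A \<in> Pow (edges G). w A * (if S \<subseteq> \<Union>(ends G ` A) then 1 else 0)) =
      (- 1) ^ card S * (if S = {} then ?n - 1 else if card S = 1 then 1 else 0)
      - (if card S = k then ?c S - 1 else 0)"
      by (simp add: right_diff_distrib flip: mult.assoc power_add)
  qed
  also have "\<dots> = (\<Sum>S \<in> ?P. (- 1) ^ card S * (if S = {} then ?n - 1 else if card S = 1 then 1 else 0))
      - (\<Sum>S \<in> ?P. if card S = k then ?c S - 1 else 0)"
    by (rule sum_subtractf)
  \<comment> \<open>As \<open>k\<close> is positive, all singletons of vertices occur among the sets \<open>S\<close>.\<close>
  also have "(\<Sum>S \<in> ?P. (- 1) ^ card S * (if S = {} then ?n - 1 else if card S = 1 then 1 else 0)) =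
      (\<Sum>S \<in> insert {} ((\<lambda>x. {x}) ` verts G). if S = {} then ?n - 1 else - 1)"
    using P assms(1)
    by (intro sum.mono_neutral_cong_right) (auto simp: card_1_singleton_iff)
  also have "\<dots> = - 1"
    using fin(1) by (subst sum.insert) (auto simp: sum.reindex)
  also have "(\<Sum>S \<in> ?P. if card S = k then ?c S - 1 else 0) =
      (\<Sum>S \<in> {S. S \<subseteq> verts G \<and> card S = k}. ?c S - 1)"
    using P by (intro sum.mono_neutral_cong_right) auto
  finally show ?thesis by simp
qed

end
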